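(* Let $\omega>0$, let $m\ge 1$ be an integer, and let $a, b_i, \tau_i : [0,\infty)\to\mathbb{R}$ ($i=1,\dots,m$) be essentially bounded Borel measurable functions with $\tau_i(t)\ge 0$ for all $t\ge 0$. Assume: (1) $a(t+\omega)=a(t)$, $b_i(t+\omega)=b_i(t)$, $\tau_i(t+\omega)=\tau_i(t)$ for all $t\in[0,\infty)$ and $i=1,\dots,m$; (2) $t-\tau_i(t)\ge 0$ for all $t\in[0,\omega]$ and $i=1,\dots,m$. Consider the homogeneous delay differential equation $$x''(t)+a(t)x'(t)+\sum_{i=1}^m b_i(t)\,x(t-\tau_i(t))=0,\quad t\in[0,\infty),\qquad x(\xi)=0 \text{ for } \xi<0. \qquad ( * )$$ Let $x_1,x_2$ be the solutions of $( * )$ with $x_1(0)=1$, $x_1'(0)=0$ and $x_2(0)=0$, $x_2'(0)=1$, and let $$W(t)=x_1(t)x_2'(t)-x_2(t)x_1'(t).$$ Then there exist nontrivial (possibly complex-valued) solutions $x$ of $( * )$ satisfying, for some $\lambda\in\mathbb{C}$, $$x(t+\omega)=\lambda x(t)\quad\text{for all } t\in[0,\infty),$$ and the numbers $\lambda\in\mathbb{C}$ for which such a nontrivial solution exists are exactly the roots of the quadratic equation $$\lambda^2-\bigl(x_1(\omega)+x_2'(\omega)\bigr)\lambda+W(\omega)=0.$$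
   Context: A solution of the equation is a function $x:[0,\infty)\to\mathbb{C}$ (real-valued for real initial data $x(0),x'(0)$) that is differentiable, whose derivative $x'$ is absolutely continuous on every finite interval $[0,T]$, and which satisfies the equation for almost every $t\in[0,\infty)$, where $x(t-\tau_i(t))$ is replaced by $0$ whenever $t-\tau_i(t)<0$ (zero initial function). For every pair of initial values $x(0),x'(0)$ there is a unique solution, so the solution space is two-dimensional, spanned by $x_1,x_2$. A solution is nontrivial if it is not identically zero on $[0,\infty)$. *)

theory Defs
  imports "HOL-Analysis.Analysis"
begin

text \<open>
  The equation lives on the half-line, so functions on the half-line are total functions on
  \<^typ>\<open>real\<close> whose values at negative arguments are never inspected: derivatives are taken
  within \<^term>\<open>{0::real..}\<close>, hence one-sided at \<^term>\<open>0::real\<close>.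
\<close>

definition hderiv :: "(real \<Rightarrow> complex) \<Rightarrow> real \<Rightarrow> complex" where
  "hderiv x t = vector_derivative x (at t within {0..})"

definition ess_bounded_borel :: "(real \<Rightarrow> real) \<Rightarrow> bool" where
  "ess_bounded_borel f \<longleftrightarrow>
     f \<in> borel_measurable (restrict_space borel {0..}) \<and>
     (\<exists>C. AE t in restrict_space lborel {0..}. \<bar>f t\<bar> \<le> C)"

text \<open>
  Absolute continuity of a function on a set (here always an interval), in the epsilon-delta sense;
  the library's \<^const>\<open>absolutely_continuous\<close> is about measures. A pair \<open>(u, v)\<close>
  encodes the interval from \<open>u\<close> to \<open>v\<close>.
\<close>

definition abs_continuous_on :: "real set \<Rightarrow> (real \<Rightarrow> 'a::real_normed_vector) \<Rightarrow> bool" where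
  "abs_continuous_on S f \<longleftrightarrow>
     (\<forall>\<epsilon>>0. \<exists>\<delta>>0. \<forall>P.
        finite P \<and> (\<forall>(u, v)\<in>P. u \<le> v \<and> {u..v} \<subseteq> S) \<and>
        disjoint_family_on (\<lambda>(u, v). {u<..<v}) P \<and>
        (\<Sum>(u, v)\<in>P. v - u) < \<delta>
        \<longrightarrow> (\<Sum>(u, v)\<in>P. norm (f v - f u)) < \<epsilon>)"

definition zero_ext :: "(real \<Rightarrow> complex) \<Rightarrow> real \<Rightarrow> complex" where
  "zero_ext x s = (if s < 0 then 0 else x s)"

text \<open>
  The second derivative is quantified existentially, so that the almost-everywhere clause asserts
  that it exists at \<open>t\<close> and that the equation holds there.
\<close>

definition dde_solution ::
  "nat \<Rightarrow> (real \<Rightarrow> real) \<Rightarrow> (nat \<Rightarrow> real \<Rightarrow> real) \<Rightarrow> (nat \<Rightarrow> real \<Rightarrow> real) \<Rightarrow> (real \<Rightarrow> complex) \<Rightarrow> bool" where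
  "dde_solution m a b \<tau> x \<longleftrightarrow>
     x differentiable_on {0..} \<and>
     (\<forall>T\<ge>0. abs_continuous_on {0..T} (hderiv x)) \<and>
     (AE t in restrict_space lborel {0..}.
        \<exists>x''. (hderiv x has_vector_derivative x'') (at t within {0..}) \<and>
          x'' + of_real (a t) * hderiv x t
            + (\<Sum>i = 1..m. of_real (b i t) * zero_ext x (t - \<tau> i t)) = 0)"

definition nontrivial :: "(real \<Rightarrow> complex) \<Rightarrow> bool" where
  "nontrivial x \<longleftrightarrow> (\<exists>t\<ge>0. x t \<noteq> 0)"

definition wronskian :: "(real \<Rightarrow> complex) \<Rightarrow> (real \<Rightarrow> complex) \<Rightarrow> real \<Rightarrow> complex" where
  "wronskian x\<^sub>1 x\<^sub>2 t = x\<^sub>1 t * hderiv x\<^sub>2 t - x\<^sub>2 t * hderiv x\<^sub>1 t"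

definition floquet_solution ::
  "nat \<Rightarrow> (real \<Rightarrow> real) \<Rightarrow> (nat \<Rightarrow> real \<Rightarrow> real) \<Rightarrow> (nat \<Rightarrow> real \<Rightarrow> real) \<Rightarrow> real \<Rightarrow> complex
    \<Rightarrow> (real \<Rightarrow> complex) \<Rightarrow> bool" where
  "floquet_solution m a b \<tau> \<omega> \<mu> x \<longleftrightarrow>
     dde_solution m a b \<tau> x \<and> nontrivial x \<and> (\<forall>t\<ge>0. x (t + \<omega>) = \<mu> * x t)"

end

theory Submission
  imports Defs
begin

text \<open>
  Translation by the period acts on solutions. By periodicity of the delays, the hypothesis
  \<open>t - \<tau> i t \<ge> 0\<close> on one period holds on the whole half-line, so no delayed argument is
  ever cut off by the zero initial function; together with the periodicity of the coefficients,
  this makes \<open>t \<mapsto> x (t + \<omega>)\<close> a solution whenever \<open>x\<close> is one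
  (\<open>dde_solution_translate\<close>). Since a solution is determined by its data \<open>(x 0, x' 0)\<close>
  (\<open>dde_solution_unique\<close>), the monodromy map is, in the basis \<open>x\<^sub>1\<close>, \<open>x\<^sub>2\<close>, the matrix with
  rows \<open>(x\<^sub>1 \<omega>, x\<^sub>2 \<omega>)\<close> and \<open>(x\<^sub>1' \<omega>, x\<^sub>2' \<omega>)\<close>. A Floquet solution with multiplier \<open>\<mu>\<close> is
  the same thing as an eigenvector for the eigenvalue \<open>\<mu>\<close>: both sides of
  \<open>x (t + \<omega>) = \<mu> x t\<close> are solutions, so it suffices to compare their data at 0. The
  quadratic equation is the characteristic equation of this matrix, whose determinant is the
  Wronskian at \<open>\<omega>\<close>, and it has a complex root.

  The analytic core is uniqueness. A solution with zero data that vanishes up to \<open>s\<close> also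
  vanishes up to \<open>s + h\<close>, for a step \<open>h \<le> 1\<close> depending only on
  \<open>m\<close> and the bound \<open>C\<close> of the coefficients: if
  \<open>M\<close> is the maximum of \<open>|x'|\<close> on \<open>[s, s + h]\<close>, then \<open>|x| \<le> h M \<le> M\<close> there, hence
  \<open>|x''| \<le> C (1 + m) M\<close> almost everywhere, hence \<open>M \<le> C (1 + m) h M \<le> M / 2\<close>. The last
  step needs the fact that an absolutely continuous function changes by at most \<open>K\<close> times the
  length of the interval when \<open>K\<close> bounds its derivative only almost everywhere
  (\<open>abs_continuous_AE_derivative_bound\<close>). It is proved on a tagged division
  fine for a suitable gauge: the intervals tagged in the exceptional null set have small total
  length, so absolute continuity controls them, and on all others the derivative does.
\<close>

section \<open>Absolutely continuous functions\<close>

definition interval_family :: "real set \<Rightarrow> real \<Rightarrow> (real \<times> real) set \<Rightarrow> bool" where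
  "interval_family S \<delta> P \<longleftrightarrow>
     finite P \<and> (\<forall>(u, v)\<in>P. u \<le> v \<and> {u..v} \<subseteq> S) \<and>
     disjoint_family_on (\<lambda>(u, v). {u<..<v}) P \<and> (\<Sum>(u, v)\<in>P. v - u) < \<delta>"

lemma abs_continuous_on_iff:
  "abs_continuous_on S f \<longleftrightarrow>
     (\<forall>\<epsilon>>0. \<exists>\<delta>>0. \<forall>P. interval_family S \<delta> P \<longrightarrow> (\<Sum>(u, v)\<in>P. norm (f v - f u)) < \<epsilon>)"
  unfolding abs_continuous_on_def interval_family_def by simp

lemma tagged_division_real_interval:
  assumes "p tagged_division_of {u..v}" "(t, L) \<in> p"
  obtains c d where "L = {c..d}" "c \<le> t" "t \<le> d" "u \<le> c" "d \<le> v"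
    "Inf L = c" "Sup L = d" "measure lborel L = d - (c::real)"
proof -
  obtain c d where L: "L = {c..d}"
    using tagged_division_ofD(4)[OF assms] by auto
  moreover have "t \<in> L" "L \<subseteq> {u..v}"
    using tagged_division_ofD(2,3)[OF assms] by auto
  ultimately show ?thesis
    using that[of c d] by auto
qed

lemma tagged_division_sum_content:
  assumes "p tagged_division_of {u..v}" "u \<le> (v::real)"
  shows "(\<Sum>(t, L)\<in>p. measure lborel L) = v - u"
proof -
  have "(\<Sum>(t, L)\<in>p. measure lborel L) = (\<Sum>(t, L)\<in>p. Sup L - Inf L)"
    by (rule sum.cong) (auto elim!: tagged_division_real_interval[OF assms(1)])
  then show ?thesis
    using additive_tagged_division_1[OF assms(2,1), of "\<lambda>x. x"] by simp
qed

text \<open>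
  Absolute continuity speaks of sets of end-point pairs; this transfers it to any part of a
  tagged division, where an interval could a priori occur with several tags.
\<close>

lemma abs_continuous_on_tagged_division:
  fixes f :: "real \<Rightarrow> 'a::real_normed_vector"
  assumes ac: "abs_continuous_on {u..v} f" and "\<epsilon> > 0"
  shows "\<exists>\<delta>>0. \<forall>p q. p tagged_division_of {u..v} \<longrightarrow> q \<subseteq> p \<longrightarrow> (\<Sum>(t, L)\<in>q. measure lborel L) < \<delta> \<longrightarrow>
       (\<Sum>(t, L)\<in>q. norm (f (Sup L) - f (Inf L))) < \<epsilon>"
proof -
  obtain \<delta> where "\<delta> > 0" and \<delta>: "\<forall>P. interval_family {u..v} \<delta> P \<longrightarrow>
        (\<Sum>(c, d)\<in>P. norm (f d - f c)) < \<epsilon>"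
    using assms unfolding abs_continuous_on_iff by meson
  show ?thesis
  proof (intro exI[of _ \<delta>] conjI allI impI)
    show "\<delta> > 0" by fact
    fix p q
    assume p: "p tagged_division_of {u..v}" and q: "q \<subseteq> p" and small: "(\<Sum>(t, L)\<in>q. measure lborel L) < \<delta>"
    define e where "e = (\<lambda>(t::real, L::real set). (Inf L, Sup L))"
    have "finite q"
      using tagged_division_ofD(1)[OF p] q finite_subset by blast
    have int: "\<exists>c d. L = {c..d} \<and> c \<le> t \<and> t \<le> d \<and> u \<le> c \<and> d \<le> v \<and> Inf L = c \<and> Sup L = d
        \<and> measure lborel L = d - c" if "(t, L) \<in> q" for t L
      using tagged_division_real_interval[OF p, of t L] q that by blast
    have disj: "{Inf L<..<Sup L} \<inter> {Inf L'<..<Sup L'} = {}"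
      if "(t, L) \<in> q" "(t', L') \<in> q" "(t, L) \<noteq> (t', L')" for t L t' L'
    proof -
      have "interior L \<inter> interior L' = {}"
        using tagged_division_ofD(5)[OF p] that q by blast
      moreover have "interior L = {Inf L<..<Sup L}" "interior L' = {Inf L'<..<Sup L'}"
        using int[OF that(1)] int[OF that(2)] interior_atLeastAtMost_real by metis+
      ultimately show ?thesis by simp
    qed
    \<comment> \<open>A degenerate interval carries only one possible tag, and two nondegenerate ones with
        the same end points would overlap.\<close>
    have inj: "inj_on e q"
    proof (rule inj_onI, clarify)
      fix t L t' L'
      assume *: "(t, L) \<in> q" "(t', L') \<in> q" "e (t, L) = e (t', L')"
      show "t = t' \<and> L = L'"
      proof (rule ccontr)
        assume "\<not> (t = t' \<and> L = L')"
        then have ne: "(t, L) \<noteq> (t', L')" by blast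
        have eq: "Inf L = Inf L'" "Sup L = Sup L'" using *(3) by (auto simp: e_def)
        from disj[OF *(1,2) ne] eq have "\<not> Inf L < Sup L"
          by (metis Int_absorb greaterThanLessThan_empty_iff linorder_not_less)
        with int[OF *(1)] int[OF *(2)] eq ne show False by force
      qed
    qed
    have "(\<Sum>(c, d)\<in>e ` q. norm (f d - f c)) < \<epsilon>"
    proof (rule \<delta>[rule_format], unfold interval_family_def, intro conjI)
      show "finite (e ` q)" using \<open>finite q\<close> by simp
      show "\<forall>(c, d)\<in>e ` q. c \<le> d \<and> {c..d} \<subseteq> {u..v}"
        using int by (fastforce simp: e_def)
      show "disjoint_family_on (\<lambda>(c, d). {c<..<d}) (e ` q)"
        unfolding disjoint_family_on_def
      proof (intro ballI impI)
        fix i j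
        assume "i \<in> e ` q" "j \<in> e ` q" "i \<noteq> j"
        then obtain t L t' L' where "(t, L) \<in> q" "i = e (t, L)" "(t', L') \<in> q" "j = e (t', L')"
          by (metis imageE surj_pair)
        with disj[of t L t' L'] \<open>i \<noteq> j\<close>
        show "(case i of (c, d) \<Rightarrow> {c<..<d}) \<inter> (case j of (c, d) \<Rightarrow> {c<..<d}) = {}"
          by (auto simp: e_def)
      qed
      have "(\<Sum>(c, d)\<in>e ` q. d - c) = (\<Sum>(t, L)\<in>q. Sup L - Inf L)"
        by (subst sum.reindex[OF inj]) (simp add: e_def case_prod_unfold)
      also have "\<dots> = (\<Sum>(t, L)\<in>q. measure lborel L)"
        by (rule sum.cong) (use int in fastforce)+
      finally show "(\<Sum>(c, d)\<in>e ` q. d - c) < \<delta>" using small by simp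
    qed
    also have "(\<Sum>(c, d)\<in>e ` q. norm (f d - f c)) = (\<Sum>(t, L)\<in>q. norm (f (Sup L) - f (Inf L)))"
      by (subst sum.reindex[OF inj]) (simp add: e_def case_prod_unfold)
    finally show "(\<Sum>(t, L)\<in>q. norm (f (Sup L) - f (Inf L))) < \<epsilon>" .
  qed
qed

text \<open>
  The sum is a Riemann sum of the indicator function of the null set, whose
  Henstock-Kurzweil integral is 0.
\<close>

lemma negligible_gauge:
  fixes N :: "real set"
  assumes "negligible N" and "\<delta> > 0"
  shows "\<exists>\<gamma>. gauge \<gamma> \<and> (\<forall>p. p tagged_division_of {u..v} \<longrightarrow> \<gamma> fine p \<longrightarrow>
       (\<Sum>(t, L)\<in>{(t, L)\<in>p. t \<in> N}. measure lborel L) < \<delta>)"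
proof -
  have "((indicat_real N) has_integral 0) (cbox u v)"
    using assms(1) by (simp add: negligible_def)
  then obtain \<gamma> where "gauge \<gamma>" and \<gamma>: "\<And>p. p tagged_division_of {u..v} \<Longrightarrow> \<gamma> fine p \<Longrightarrow>
       norm ((\<Sum>(t, L)\<in>p. measure lborel L *\<^sub>R indicat_real N t) - 0) < \<delta>"
    using assms(2) unfolding has_integral by (metis box_real(2))
  show ?thesis
  proof (intro exI[of _ \<gamma>] conjI allI impI)
    show "gauge \<gamma>" by fact
    fix p
    assume p: "p tagged_division_of {u..v}" "\<gamma> fine p"
    have "(\<Sum>(t, L)\<in>{(t, L)\<in>p. t \<in> N}. measure lborel L) = (\<Sum>(t, L)\<in>p. measure lborel L *\<^sub>R indicat_real N t)"
      using tagged_division_ofD(1)[OF p(1)]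
      by (intro sum.mono_neutral_cong_left) (auto simp: indicator_def)
    then show "(\<Sum>(t, L)\<in>{(t, L)\<in>p. t \<in> N}. measure lborel L) < \<delta>"
      using \<gamma>[OF p] by simp
  qed
qed

text \<open>
  Straddle lemma: the difference quotient over an interval containing its tag is a convex
  combination of the two difference quotients based at the tag, so closeness to the tag bounds it.
\<close>

lemma straddle_gauge:
  fixes f :: "real \<Rightarrow> 'a::real_normed_vector"
  assumes diff: "\<forall>t\<in>S - N. \<exists>d. (f has_vector_derivative d) (at t within S) \<and> norm d \<le> K"
    and "\<epsilon> > 0"
  shows "\<exists>\<gamma>. gauge \<gamma> \<and> (\<forall>t c d. t \<in> S - N \<longrightarrow> c \<le> t \<longrightarrow> t \<le> d \<longrightarrow> c \<in> S \<longrightarrow> d \<in> S \<longrightarrow> {c..d} \<subseteq> \<gamma> t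
       \<longrightarrow> norm (f d - f c) \<le> (K + \<epsilon>) * (d - c))"
proof -
  have "\<exists>r>0. t \<in> S - N \<longrightarrow> (\<forall>y\<in>S. \<bar>y - t\<bar> < r \<longrightarrow> norm (f y - f t) \<le> (K + \<epsilon>) * \<bar>y - t\<bar>)" for t
  proof (cases "t \<in> S - N")
    case True
    then obtain d where d: "(f has_vector_derivative d) (at t within S)" "norm d \<le> K"
      using diff by blast
    then obtain r where "r > 0" and r: "\<And>y. y \<in> S \<Longrightarrow> \<bar>y - t\<bar> < r \<Longrightarrow>
        norm (f y - f t - (y - t) *\<^sub>R d) \<le> \<epsilon> * \<bar>y - t\<bar>"
      using \<open>\<epsilon> > 0\<close> unfolding has_vector_derivative_def has_derivative_within_alt real_norm_def by blast
    have "norm (f y - f t) \<le> (K + \<epsilon>) * \<bar>y - t\<bar>" if "y \<in> S" "\<bar>y - t\<bar> < r" for y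
    proof -
      have "norm (f y - f t) \<le> norm (f y - f t - (y - t) *\<^sub>R d) + norm ((y - t) *\<^sub>R d)"
        by (metis diff_add_cancel norm_triangle_ineq)
      also have "norm ((y - t) *\<^sub>R d) \<le> \<bar>y - t\<bar> * K"
        using d(2) by (simp add: mult_left_mono)
      finally show ?thesis using r[OF that] by (simp add: algebra_simps)
    qed
    with \<open>r > 0\<close> show ?thesis by blast
  qed (use zero_less_one in blast)
  then obtain r where r0: "\<And>t. r t > 0" and r: "\<And>t y. \<lbrakk>t \<in> S - N; y \<in> S; \<bar>y - t\<bar> < r t\<rbrakk> \<Longrightarrow>
      norm (f y - f t) \<le> (K + \<epsilon>) * \<bar>y - t\<bar>"
    by metis
  show ?thesis
  proof (intro exI[of _ "\<lambda>t. ball t (r t)"] conjI allI impI)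
    show "gauge (\<lambda>t. ball t (r t))" using r0 by (intro gauge_ball_dependent) auto
    fix t c d
    assume *: "t \<in> S - N" "c \<le> t" "t \<le> d" "c \<in> S" "d \<in> S" "{c..d} \<subseteq> ball t (r t)"
    have "c \<in> {c..d}" "d \<in> {c..d}" using *(2,3) by auto
    with *(6) have "c \<in> ball t (r t)" "d \<in> ball t (r t)" by blast+
    then have "norm (f c - f t) \<le> (K + \<epsilon>) * \<bar>c - t\<bar>" "norm (f d - f t) \<le> (K + \<epsilon>) * \<bar>d - t\<bar>"
      using * by (intro r; simp add: dist_real_def abs_minus_commute)+
    moreover have "norm (f d - f c) \<le> norm (f d - f t) + norm (f c - f t)"
      by (metis norm_triangle_ineq4 diff_diff_eq2 diff_add_cancel)
    ultimately show "norm (f d - f c) \<le> (K + \<epsilon>) * (d - c)"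
      using * by (simp add: algebra_simps)
  qed
qed

text \<open>
  By Cousin's lemma there is a tagged division fine for both gauges above; the increment of \<open>f\<close>
  telescopes over it.
\<close>

lemma abs_continuous_AE_derivative_bound:
  fixes f :: "real \<Rightarrow> 'a::real_normed_vector"
  assumes ac: "abs_continuous_on {u..v} f" and "u \<le> v" and "0 \<le> K"
    and ae: "AE t in lborel. t \<in> {u..v} \<longrightarrow>
      (\<exists>d. (f has_vector_derivative d) (at t within {u..v}) \<and> norm d \<le> K)"
  shows "norm (f v - f u) \<le> K * (v - u)"
proof -
  obtain N where N: "N \<in> null_sets lborel" and
    diff: "\<forall>t\<in>{u..v} - N. \<exists>d. (f has_vector_derivative d) (at t within {u..v}) \<and> norm d \<le> K"
    using AE_E3[OF ae] by (metis DiffD1 DiffD2 DiffI UNIV_I space_borel space_lborel)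
  have neg: "negligible N"
    unfolding negligible_iff_null_sets by (rule null_sets_completionI[OF N])
  have "norm (f v - f u) \<le> K * (v - u) + e * (1 + (v - u))" if "e > 0" for e
  proof -
    obtain \<delta> where "\<delta> > 0" and \<delta>: "\<forall>p q. p tagged_division_of {u..v} \<longrightarrow> q \<subseteq> p \<longrightarrow>
        (\<Sum>(t, L)\<in>q. measure lborel L) < \<delta> \<longrightarrow> (\<Sum>(t, L)\<in>q. norm (f (Sup L) - f (Inf L))) < e"
      using abs_continuous_on_tagged_division[OF ac \<open>e > 0\<close>] by (elim exE conjE) (rule that)
    obtain \<gamma>1 where g1: "gauge \<gamma>1" and \<gamma>1: "\<forall>p. p tagged_division_of {u..v} \<longrightarrow> \<gamma>1 fine p \<longrightarrow>
       (\<Sum>(t, L)\<in>{(t, L)\<in>p. t \<in> N}. measure lborel L) < \<delta>"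
      using negligible_gauge[OF neg \<open>\<delta> > 0\<close>, of u v] by (elim exE conjE) (rule that)
    obtain \<gamma>2 where g2: "gauge \<gamma>2" and \<gamma>2: "\<forall>t c d. t \<in> {u..v} - N \<longrightarrow> c \<le> t \<longrightarrow> t \<le> d \<longrightarrow>
        c \<in> {u..v} \<longrightarrow> d \<in> {u..v} \<longrightarrow> {c..d} \<subseteq> \<gamma>2 t \<longrightarrow> norm (f d - f c) \<le> (K + e) * (d - c)"
      using straddle_gauge[OF diff \<open>e > 0\<close>] by (elim exE conjE) (rule that)
    obtain p where p: "p tagged_division_of {u..v}" and "(\<lambda>t. \<gamma>1 t \<inter> \<gamma>2 t) fine p"
      using fine_division_exists_real[OF gauge_Int[OF g1 g2]] by metis
    then have fine: "\<gamma>1 fine p" "\<gamma>2 fine p" by (auto simp: fine_def)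
    have finp: "finite p" using p by auto
    define q where "q = {(t, L)\<in>p. t \<in> N}"
    have q: "q \<subseteq> p" by (auto simp: q_def)
    let ?g = "\<lambda>(t::real, L). norm (f (Sup L) - f (Inf L))"
    have "f v - f u = (\<Sum>(t, L)\<in>p. f (Sup L) - f (Inf L))"
      using additive_tagged_division_1[OF \<open>u \<le> v\<close> p, of f] by simp
    also have "norm \<dots> \<le> sum ?g p"
      by (rule order_trans[OF norm_sum]) (simp add: case_prod_unfold)
    also have "\<dots> = sum ?g q + sum ?g (p - q)"
      using sum.subset_diff[OF q finp, of ?g] by simp
    also have "sum ?g q < e"
      using \<delta>[rule_format, OF p q] \<gamma>1[rule_format, OF p fine(1)] unfolding q_def by blast
    also have "sum ?g (p - q) \<le> (\<Sum>(t, L)\<in>p - q. (K + e) * measure lborel L)"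
    proof (rule sum_mono, clarify)
      fix t L
      assume *: "(t, L) \<in> p" "(t, L) \<notin> q"
      then have "L \<subseteq> \<gamma>2 t" "t \<notin> N" using fine(2) by (auto simp: fine_def q_def)
      with *(1) show "norm (f (Sup L) - f (Inf L)) \<le> (K + e) * measure lborel L"
        using \<gamma>2[rule_format, of t] by (elim tagged_division_real_interval[OF p]) simp
    qed
    also have "\<dots> \<le> (\<Sum>(t, L)\<in>p. (K + e) * measure lborel L)"
      using finp \<open>0 \<le> K\<close> \<open>e > 0\<close> by (intro sum_mono2) auto
    also have "\<dots> = (K + e) * (v - u)"
      using tagged_division_sum_content[OF p \<open>u \<le> v\<close>]
      by (simp add: case_prod_unfold flip: sum_distrib_left)
    finally show ?thesis by (simp add: algebra_simps)
  qed
  note est = this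
  show ?thesis
  proof (rule field_le_epsilon)
    fix e :: real
    assume "e > 0"
    have pos: "1 + (v - u) > 0" using \<open>u \<le> v\<close> by simp
    show "norm (f v - f u) \<le> K * (v - u) + e"
      using est[of "e / (1 + (v - u))"] \<open>e > 0\<close> pos by simp
  qed
qed

lemma abs_continuous_on_imp_continuous_on:
  assumes "abs_continuous_on {u..v::real} f"
  shows "continuous_on {u..v} f"
  unfolding continuous_on_iff
proof (intro ballI allI impI)
  fix t \<epsilon> :: real
  assume t: "t \<in> {u..v}" and "\<epsilon> > 0"
  then obtain \<delta> where "\<delta> > 0" and \<delta>: "\<forall>P. interval_family {u..v} \<delta> P \<longrightarrow>
        (\<Sum>(c, d)\<in>P. norm (f d - f c)) < \<epsilon>"
    using assms unfolding abs_continuous_on_iff by meson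
  have step: "norm (f d - f c) < \<epsilon>" if "c \<le> d" "u \<le> c" "d \<le> v" "d - c < \<delta>" for c d
    using \<delta>[rule_format, of "{(c, d)}"] that
    by (simp add: interval_family_def disjoint_family_on_def)
  have "dist (f s) (f t) < \<epsilon>" if "s \<in> {u..v}" "dist s t < \<delta>" for s
    using step[of s t] step[of t s] that t
    by (cases "s \<le> t") (auto simp: dist_real_def dist_norm norm_minus_commute)
  with \<open>\<delta> > 0\<close> show "\<exists>d>0. \<forall>s\<in>{u..v}. dist s t < d \<longrightarrow> dist (f s) (f t) < \<epsilon>" by blast
qed

lemma abs_continuous_on_subset:
  assumes "abs_continuous_on T f" "S \<subseteq> T"
  shows "abs_continuous_on S f"
proof -
  have "interval_family T \<delta> P" if "interval_family S \<delta> P" for \<delta> P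
    using that assms(2) unfolding interval_family_def by blast
  with assms(1) show ?thesis unfolding abs_continuous_on_iff by meson
qed

lemma abs_continuous_on_cong:
  assumes "\<And>t. t \<in> S \<Longrightarrow> f t = g t"
  shows "abs_continuous_on S f \<longleftrightarrow> abs_continuous_on S g"
proof -
  have "(\<Sum>(u, v)\<in>P. norm (f v - f u)) = (\<Sum>(u, v)\<in>P. norm (g v - g u))"
    if P: "interval_family S \<delta> P" for P \<delta>
  proof (rule sum.cong, simp, clarify)
    fix u v
    assume "(u, v) \<in> P"
    then have "u \<le> v" "{u..v} \<subseteq> S" using P by (auto simp: interval_family_def)
    then have "u \<in> S" "v \<in> S" by auto
    then show "norm (f v - f u) = norm (g v - g u)" using assms by simp
  qed
  then show ?thesis unfolding abs_continuous_on_iff by simp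
qed

lemma abs_continuous_on_lincomb:
  fixes f g :: "real \<Rightarrow> complex"
  assumes "abs_continuous_on S f" "abs_continuous_on S g"
  shows "abs_continuous_on S (\<lambda>t. c * f t + d * g t)"
  unfolding abs_continuous_on_iff
proof (intro allI impI)
  fix \<epsilon> :: real
  assume "\<epsilon> > 0"
  define \<eta> where "\<eta> = \<epsilon> / (norm c + norm d + 1)"
  have pos: "norm c + norm d + 1 > 0"
    by (simp add: add_nonneg_pos)
  have "\<eta> > 0" using \<open>\<epsilon> > 0\<close> pos by (simp add: \<eta>_def)
  obtain \<delta>1 where "\<delta>1 > 0" and \<delta>1: "\<And>P. interval_family S \<delta>1 P \<Longrightarrow> (\<Sum>(u, v)\<in>P. norm (f v - f u)) < \<eta>"
    using assms(1) \<open>\<eta> > 0\<close> unfolding abs_continuous_on_iff by meson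
  obtain \<delta>2 where "\<delta>2 > 0" and \<delta>2: "\<And>P. interval_family S \<delta>2 P \<Longrightarrow> (\<Sum>(u, v)\<in>P. norm (g v - g u)) < \<eta>"
    using assms(2) \<open>\<eta> > 0\<close> unfolding abs_continuous_on_iff by meson
  have "(\<Sum>(u, v)\<in>P. norm (c * f v + d * g v - (c * f u + d * g u))) < \<epsilon>"
    if "interval_family S (min \<delta>1 \<delta>2) P" for P
  proof -
    have "(\<Sum>(u, v)\<in>P. norm (c * f v + d * g v - (c * f u + d * g u))) \<le>
        (\<Sum>(u, v)\<in>P. norm c * norm (f v - f u) + norm d * norm (g v - g u))"
    proof (rule sum_mono, clarify)
      fix u v
      have "c * f v + d * g v - (c * f u + d * g u) = c * (f v - f u) + d * (g v - g u)"
        by (simp add: algebra_simps)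
      then show "norm (c * f v + d * g v - (c * f u + d * g u))
          \<le> norm c * norm (f v - f u) + norm d * norm (g v - g u)"
        by (metis norm_mult norm_triangle_ineq)
    qed
    also have "\<dots> = norm c * (\<Sum>(u, v)\<in>P. norm (f v - f u)) + norm d * (\<Sum>(u, v)\<in>P. norm (g v - g u))"
      by (simp add: case_prod_unfold sum.distrib sum_distrib_left)
    also have "\<dots> \<le> norm c * \<eta> + norm d * \<eta>"
      using \<delta>1[of P] \<delta>2[of P] that
      by (intro add_mono mult_left_mono) (auto simp: interval_family_def)
    also have "\<dots> < (norm c + norm d + 1) * \<eta>"
      using \<open>\<eta> > 0\<close> by (simp add: algebra_simps)
    also have "\<dots> = \<epsilon>" using pos by (simp add: \<eta>_def)
    finally show ?thesis .
  qed
  then show "\<exists>\<delta>>0. \<forall>P. interval_family S \<delta> P \<longrightarrow>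
      (\<Sum>(u, v)\<in>P. norm (c * f v + d * g v - (c * f u + d * g u))) < \<epsilon>"
    using \<open>\<delta>1 > 0\<close> \<open>\<delta>2 > 0\<close> by (intro exI[of _ "min \<delta>1 \<delta>2"]) auto
qed

lemma abs_continuous_on_translate:
  assumes "abs_continuous_on T f" and sub: "\<And>t. t \<in> S \<Longrightarrow> t + w \<in> T"
  shows "abs_continuous_on S (\<lambda>t. f (t + w))"
  unfolding abs_continuous_on_iff
proof (intro allI impI)
  fix \<epsilon> :: real
  assume "\<epsilon> > 0"
  then obtain \<delta> where "\<delta> > 0" and \<delta>: "\<forall>P. interval_family T \<delta> P \<longrightarrow>
        (\<Sum>(c, d)\<in>P. norm (f d - f c)) < \<epsilon>"
    using assms(1) unfolding abs_continuous_on_iff by meson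
  have "(\<Sum>(u, v)\<in>P. norm (f (v + w) - f (u + w))) < \<epsilon>"
    if "interval_family S \<delta> P" for P
  proof -
    have P: "finite P" "\<forall>(u, v)\<in>P. u \<le> v \<and> {u..v} \<subseteq> S"
      "disjoint_family_on (\<lambda>(u, v). {u<..<v}) P" "(\<Sum>(u, v)\<in>P. v - u) < \<delta>"
      using that by (auto simp: interval_family_def)
    define e where "e = (\<lambda>(u, v). (u + w, v + w))"
    have inj: "inj_on e P" by (auto simp: e_def inj_on_def)
    have "(\<Sum>(c, d)\<in>e ` P. norm (f d - f c)) < \<epsilon>"
    proof (rule \<delta>[rule_format], unfold interval_family_def, intro conjI)
      show "finite (e ` P)" using P by simp
      show "\<forall>(c, d)\<in>e ` P. c \<le> d \<and> {c..d} \<subseteq> T"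
      proof (clarsimp simp: e_def)
        fix u v assume uv: "(u, v) \<in> P"
        show "u \<le> v \<and> {u + w..v + w} \<subseteq> T"
        proof (intro conjI subsetI)
          show "u \<le> v" using P(2) uv by auto
          fix z assume "z \<in> {u + w..v + w}"
          then have "z - w \<in> S" using P(2) uv by force
          from sub[OF this] show "z \<in> T" by simp
        qed
      qed
      show "disjoint_family_on (\<lambda>(c, d). {c<..<d}) (e ` P)"
        unfolding disjoint_family_on_def
      proof (intro ballI impI)
        fix i j
        assume "i \<in> e ` P" "j \<in> e ` P" "i \<noteq> j"
        then obtain u v u' v' where *: "(u, v) \<in> P" "i = e (u, v)" "(u', v') \<in> P" "j = e (u', v')"
          "(u, v) \<noteq> (u', v')"
          by (metis imageE surj_pair)
        have "{u<..<v} \<inter> {u'<..<v'} = {}"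
          using P(3) * unfolding disjoint_family_on_def by fast
        then show "(case i of (c, d) \<Rightarrow> {c<..<d}) \<inter> (case j of (c, d) \<Rightarrow> {c<..<d}) = {}"
          unfolding * e_def by (simp add: Int_greaterThanLessThan)
      qed
      show "(\<Sum>(c, d)\<in>e ` P. d - c) < \<delta>"
        using P(4) by (subst sum.reindex[OF inj]) (simp add: e_def case_prod_unfold)
    qed
    then show ?thesis
      by (subst (asm) sum.reindex[OF inj]) (simp add: e_def case_prod_unfold)
  qed
  with \<open>\<delta> > 0\<close> show "\<exists>\<delta>>0. \<forall>P. interval_family S \<delta> P \<longrightarrow>
        (\<Sum>(u, v)\<in>P. norm (f (v + w) - f (u + w))) < \<epsilon>"
    by blast
qed

section \<open>The solution space and its invariance under the period\<close>

lemma at_within_Ici_neq_bot: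
  fixes t :: real
  assumes "t \<ge> 0"
  shows "at t within {0..} \<noteq> bot"
proof -
  have "t islimpt {t..t + 1}"
    by (simp add: islimpt_Icc)
  then have "t islimpt {0..}"
    by (rule islimpt_subset) (use assms in auto)
  then show ?thesis
    by (simp add: trivial_limit_within)
qed

lemma hderiv_eqI:
  assumes "(x has_vector_derivative d) (at t within {0..})" and "t \<ge> 0"
  shows "hderiv x t = d"
  unfolding hderiv_def using assms at_within_Ici_neq_bot vector_derivative_within by blast

text \<open>
  The function \<open>v\<close> stands for the first derivative. Keeping it separate from \<^term>\<open>hderiv x\<close> lets a
  closed-form candidate, such as a translate or a linear combination, be verified directly.
\<close>

definition dde_holds_at ::
  "nat \<Rightarrow> (real \<Rightarrow> real) \<Rightarrow> (nat \<Rightarrow> real \<Rightarrow> real) \<Rightarrow> (nat \<Rightarrow> real \<Rightarrow> real)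
    \<Rightarrow> (real \<Rightarrow> complex) \<Rightarrow> (real \<Rightarrow> complex) \<Rightarrow> real \<Rightarrow> bool" where
  "dde_holds_at m a b \<tau> x v t \<longleftrightarrow>
     (\<exists>x''. (v has_vector_derivative x'') (at t within {0..}) \<and>
       x'' + of_real (a t) * v t + (\<Sum>i = 1..m. of_real (b i t) * zero_ext x (t - \<tau> i t)) = 0)"

lemma dde_solutionD:
  assumes "dde_solution m a b \<tau> x"
  shows "\<And>t. t \<ge> 0 \<Longrightarrow> (x has_vector_derivative hderiv x t) (at t within {0..})"
    and "\<And>T. T \<ge> 0 \<Longrightarrow> abs_continuous_on {0..T} (hderiv x)"
    and "AE t in lborel. t \<ge> 0 \<longrightarrow> dde_holds_at m a b \<tau> x (hderiv x) t"
proof -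
  show "(x has_vector_derivative hderiv x t) (at t within {0..})" if "t \<ge> 0" for t
    using assms that unfolding dde_solution_def differentiable_on_def hderiv_def
    by (simp flip: vector_derivative_works)
  show "abs_continuous_on {0..T} (hderiv x)" if "T \<ge> 0" for T
    using assms that by (simp add: dde_solution_def)
  have "AE t in restrict_space lborel {0..}. dde_holds_at m a b \<tau> x (hderiv x) t"
    using assms unfolding dde_solution_def dde_holds_at_def by blast
  then show "AE t in lborel. t \<ge> 0 \<longrightarrow> dde_holds_at m a b \<tau> x (hderiv x) t"
    by (subst (asm) AE_restrict_space_iff) auto
qed

lemma dde_solutionI:
  assumes deriv: "\<And>t. t \<ge> 0 \<Longrightarrow> (x has_vector_derivative v t) (at t within {0..})"
    and ac: "\<And>T. T \<ge> 0 \<Longrightarrow> abs_continuous_on {0..T} v"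
    and ae: "AE t in lborel. t \<ge> 0 \<longrightarrow> dde_holds_at m a b \<tau> x v t"
  shows "dde_solution m a b \<tau> x"
proof -
  have hd: "hderiv x t = v t" if "t \<ge> 0" for t
    using hderiv_eqI deriv that by blast
  have "dde_holds_at m a b \<tau> x (hderiv x) t" if "dde_holds_at m a b \<tau> x v t" "t \<ge> 0" for t
  proof -
    obtain z where z: "(v has_vector_derivative z) (at t within {0..})"
      "z + of_real (a t) * v t + (\<Sum>i = 1..m. of_real (b i t) * zero_ext x (t - \<tau> i t)) = 0"
      using \<open>dde_holds_at m a b \<tau> x v t\<close> unfolding dde_holds_at_def by blast
    have "(hderiv x has_vector_derivative z) (at t within {0..})"
      by (rule has_vector_derivative_transform[OF _ _ z(1)]) (use hd \<open>t \<ge> 0\<close> in auto)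
    with z(2) hd[OF \<open>t \<ge> 0\<close>] show ?thesis unfolding dde_holds_at_def by auto
  qed
  with ae have "AE t in lborel. t \<in> {0..} \<longrightarrow> dde_holds_at m a b \<tau> x (hderiv x) t"
    by (auto elim!: eventually_mono)
  then have "AE t in restrict_space lborel {0..}. dde_holds_at m a b \<tau> x (hderiv x) t"
    by (subst AE_restrict_space_iff) auto
  moreover have "x differentiable_on {0..}"
    unfolding differentiable_on_def using deriv differentiableI_vector by fastforce
  moreover have "abs_continuous_on {0..T} (hderiv x)" if "T \<ge> 0" for T
    using ac[OF that] hd abs_continuous_on_cong[of "{0..T}" "hderiv x" v] by simp
  ultimately show ?thesis
    unfolding dde_solution_def dde_holds_at_def by blast
qed

lemma hderiv_lincomb:
  assumes "dde_solution m a b \<tau> x" "dde_solution m a b \<tau> y" "t \<ge> 0"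
  shows "((\<lambda>t. c * x t + d * y t) has_vector_derivative c * hderiv x t + d * hderiv y t)
      (at t within {0..})"
    and "hderiv (\<lambda>t. c * x t + d * y t) t = c * hderiv x t + d * hderiv y t"
proof -
  show *: "((\<lambda>t. c * x t + d * y t) has_vector_derivative c * hderiv x t + d * hderiv y t)
      (at t within {0..})"
    by (intro has_vector_derivative_add has_vector_derivative_mult_right
        dde_solutionD(1)[OF assms(1)] dde_solutionD(1)[OF assms(2)] assms(3))
  show "hderiv (\<lambda>t. c * x t + d * y t) t = c * hderiv x t + d * hderiv y t"
    using hderiv_eqI[OF * assms(3)] .
qed

lemma dde_solution_lincomb:
  assumes x: "dde_solution m a b \<tau> x" and y: "dde_solution m a b \<tau> y"
  shows "dde_solution m a b \<tau> (\<lambda>t. c * x t + d * y t)"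
proof (rule dde_solutionI)
  show "((\<lambda>t. c * x t + d * y t) has_vector_derivative c * hderiv x t + d * hderiv y t)
      (at t within {0..})" if "t \<ge> 0" for t
    using hderiv_lincomb(1)[OF x y that] .
  show "abs_continuous_on {0..T} (\<lambda>t. c * hderiv x t + d * hderiv y t)" if "T \<ge> 0" for T
    by (intro abs_continuous_on_lincomb dde_solutionD(2)[OF x that] dde_solutionD(2)[OF y that])
  have "dde_holds_at m a b \<tau> (\<lambda>t. c * x t + d * y t) (\<lambda>t. c * hderiv x t + d * hderiv y t) t"
    if x_at: "dde_holds_at m a b \<tau> x (hderiv x) t" and y_at: "dde_holds_at m a b \<tau> y (hderiv y) t" for t
  proof -
    obtain p where p: "(hderiv x has_vector_derivative p) (at t within {0..})"
      "p + of_real (a t) * hderiv x t + (\<Sum>i = 1..m. of_real (b i t) * zero_ext x (t - \<tau> i t)) = 0"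
      using x_at unfolding dde_holds_at_def by blast
    obtain q where q: "(hderiv y has_vector_derivative q) (at t within {0..})"
      "q + of_real (a t) * hderiv y t + (\<Sum>i = 1..m. of_real (b i t) * zero_ext y (t - \<tau> i t)) = 0"
      using y_at unfolding dde_holds_at_def by blast
    have ext: "zero_ext (\<lambda>t. c * x t + d * y t) s = c * zero_ext x s + d * zero_ext y s" for s
      by (simp add: zero_ext_def)
    have "c * p + d * q + of_real (a t) * (c * hderiv x t + d * hderiv y t)
        + (\<Sum>i = 1..m. of_real (b i t) * zero_ext (\<lambda>t. c * x t + d * y t) (t - \<tau> i t))
      = c * (p + of_real (a t) * hderiv x t + (\<Sum>i = 1..m. of_real (b i t) * zero_ext x (t - \<tau> i t)))
        + d * (q + of_real (a t) * hderiv y t + (\<Sum>i = 1..m. of_real (b i t) * zero_ext y (t - \<tau> i t)))"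
      by (simp add: ext algebra_simps sum.distrib sum_distrib_left)
    also have "\<dots> = 0" unfolding p(2) q(2) by simp
    finally show ?thesis
      unfolding dde_holds_at_def
      by (intro exI[of _ "c * p + d * q"] conjI has_vector_derivative_add
          has_vector_derivative_mult_right p q)
  qed
  with dde_solutionD(3)[OF x] dde_solutionD(3)[OF y]
  show "AE t in lborel. t \<ge> 0 \<longrightarrow>
      dde_holds_at m a b \<tau> (\<lambda>t. c * x t + d * y t) (\<lambda>t. c * hderiv x t + d * hderiv y t) t"
    by (auto elim: eventually_elim2)
qed

lemma has_vector_derivative_translate_Ici:
  assumes "(f has_vector_derivative d) (at (t + w) within {0..})" "w \<ge> (0::real)"
  shows "((\<lambda>t. f (t + w)) has_vector_derivative d) (at t within {0..})"
proof -
  have g: "((\<lambda>t. t + w) has_vector_derivative 1) (at t within {0..})"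
    by (auto intro!: derivative_eq_intros)
  have "(f has_vector_derivative d) (at (t + w) within (\<lambda>t. t + w) ` {0..})"
    using assms by (elim has_vector_derivative_within_subset) auto
  from vector_diff_chain_within[OF g this] show ?thesis
    by (simp add: o_def)
qed

lemma AE_lborel_translate:
  fixes w :: real
  assumes "AE t in lborel. P t"
  shows "AE t in lborel. P (t + w)"
proof -
  obtain N where N: "\<And>t. t \<notin> N \<Longrightarrow> P t" "N \<in> null_sets lborel"
    using AE_E3[OF assms] by auto
  have "{t. t + w \<in> N} \<in> null_sets lborel"
    using null_sets_translation[OF N(2), of "- w"] by simp
  then show ?thesis
    by (rule AE_I') (use N(1) in auto)
qed

text \<open>
  If \<open>t\<close> exceeds the period, then \<open>t - \<omega>\<close> already dominates the same delay.
\<close>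

lemma delayed_time_nonneg:
  assumes "\<omega> > 0" and per: "\<And>t. t \<ge> 0 \<Longrightarrow> r (t + \<omega>) = r t"
    and le: "\<And>t. t \<in> {0..\<omega>} \<Longrightarrow> r t \<le> t" and "t \<ge> 0"
  shows "r t \<le> (t::real)"
proof -
  have "r t \<le> t" if "0 \<le> t" "t \<le> of_nat (Suc n) * \<omega>" for n t
    using that
  proof (induction n arbitrary: t)
    case (Suc n)
    show ?case
    proof (cases "t \<le> \<omega>")
      case False
      with Suc.prems have "0 \<le> t - \<omega>" "t - \<omega> \<le> of_nat (Suc n) * \<omega>"
        by (auto simp: algebra_simps)
      with Suc.IH[of "t - \<omega>"] per[of "t - \<omega>"] \<open>\<omega> > 0\<close> show ?thesis by simp
    qed (use Suc.prems le in simp)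
  qed (use le in simp)
  moreover obtain n :: nat where "t / \<omega> \<le> of_nat n"
    using real_arch_simple by blast
  then have "t \<le> of_nat (Suc n) * \<omega>"
    using \<open>\<omega> > 0\<close> by (simp add: field_simps)
  ultimately show ?thesis using \<open>t \<ge> 0\<close> by blast
qed

text \<open>
  At time \<open>t + \<omega>\<close> the delayed argument is \<open>(t - \<tau> i t) + \<omega>\<close>. Since \<open>t - \<tau> i t \<ge> 0\<close>,
  cutting off at 0 before or after the translation makes no difference; otherwise the translate
  could see values of \<open>x\<close> on \<open>[0, \<omega>)\<close> where the equation demands 0.
\<close>

lemma
  assumes x: "dde_solution m a b \<tau> x" and "\<omega> > 0"
    and a: "\<And>t. t \<ge> 0 \<Longrightarrow> a (t + \<omega>) = a t"
    and b: "\<And>i t. i \<in> {1..m} \<Longrightarrow> t \<ge> 0 \<Longrightarrow> b i (t + \<omega>) = b i t"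
    and \<tau>: "\<And>i t. i \<in> {1..m} \<Longrightarrow> t \<ge> 0 \<Longrightarrow> \<tau> i (t + \<omega>) = \<tau> i t"
    and le: "\<And>i t. i \<in> {1..m} \<Longrightarrow> t \<in> {0..\<omega>} \<Longrightarrow> t - \<tau> i t \<ge> 0"
  shows dde_solution_translate: "dde_solution m a b \<tau> (\<lambda>t. x (t + \<omega>))"
    and hderiv_translate: "\<And>t. t \<ge> 0 \<Longrightarrow> hderiv (\<lambda>t. x (t + \<omega>)) t = hderiv x (t + \<omega>)"
proof -
  have deriv: "((\<lambda>t. x (t + \<omega>)) has_vector_derivative hderiv x (t + \<omega>)) (at t within {0..})"
    if "t \<ge> 0" for t
    using that \<open>\<omega> > 0\<close> by (intro has_vector_derivative_translate_Ici dde_solutionD(1)[OF x]) auto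
  show "hderiv (\<lambda>t. x (t + \<omega>)) t = hderiv x (t + \<omega>)" if "t \<ge> 0" for t
    using hderiv_eqI[OF deriv] that by blast
  have nonneg: "t - \<tau> i t \<ge> 0" if "i \<in> {1..m}" "t \<ge> 0" for i t
    using delayed_time_nonneg[of \<omega> "\<tau> i" t] \<open>\<omega> > 0\<close> \<tau>[OF that(1)] le[OF that(1)] that(2) by simp
  show "dde_solution m a b \<tau> (\<lambda>t. x (t + \<omega>))"
  proof (rule dde_solutionI[OF deriv])
    show "abs_continuous_on {0..T} (\<lambda>t. hderiv x (t + \<omega>))" if "T \<ge> 0" for T
      using that \<open>\<omega> > 0\<close>
      by (intro abs_continuous_on_translate[OF dde_solutionD(2)[OF x, of "T + \<omega>"]]) auto
    have "dde_holds_at m a b \<tau> (\<lambda>t. x (t + \<omega>)) (\<lambda>t. hderiv x (t + \<omega>)) t"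
      if x_at: "dde_holds_at m a b \<tau> x (hderiv x) (t + \<omega>)" and "t \<ge> 0" for t
    proof -
      obtain z where z: "(hderiv x has_vector_derivative z) (at (t + \<omega>) within {0..})"
        "z + of_real (a (t + \<omega>)) * hderiv x (t + \<omega>)
          + (\<Sum>i = 1..m. of_real (b i (t + \<omega>)) * zero_ext x (t + \<omega> - \<tau> i (t + \<omega>))) = 0"
        using x_at unfolding dde_holds_at_def by blast
      have "zero_ext x (t + \<omega> - \<tau> i (t + \<omega>)) = zero_ext (\<lambda>t. x (t + \<omega>)) (t - \<tau> i t)"
        if "i \<in> {1..m}" for i
        using nonneg[OF that \<open>t \<ge> 0\<close>] \<tau>[OF that \<open>t \<ge> 0\<close>] \<open>\<omega> > 0\<close>
        by (simp add: zero_ext_def algebra_simps)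
      then have "(\<Sum>i = 1..m. of_real (b i (t + \<omega>)) * zero_ext x (t + \<omega> - \<tau> i (t + \<omega>)))
          = (\<Sum>i = 1..m. of_real (b i t) * zero_ext (\<lambda>t. x (t + \<omega>)) (t - \<tau> i t))"
        using b[OF _ \<open>t \<ge> 0\<close>] by (intro sum.cong) auto
      with z(2) a[OF \<open>t \<ge> 0\<close>]
      have "z + of_real (a t) * hderiv x (t + \<omega>)
          + (\<Sum>i = 1..m. of_real (b i t) * zero_ext (\<lambda>t. x (t + \<omega>)) (t - \<tau> i t)) = 0"
        by simp
      moreover have "((\<lambda>t. hderiv x (t + \<omega>)) has_vector_derivative z) (at t within {0..})"
        using has_vector_derivative_translate_Ici[OF z(1)] \<open>\<omega> > 0\<close> by simp
      ultimately show ?thesis unfolding dde_holds_at_def by blast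
    qed
    then show "AE t in lborel. t \<ge> 0 \<longrightarrow>
        dde_holds_at m a b \<tau> (\<lambda>t. x (t + \<omega>)) (\<lambda>t. hderiv x (t + \<omega>)) t"
      using AE_lborel_translate[OF dde_solutionD(3)[OF x], of \<omega>] \<open>\<omega> > 0\<close>
      by (auto elim!: eventually_mono)
  qed
qed

section \<open>Uniqueness of solutions\<close>

text \<open>
  The step size \<open>h\<close> does not depend on \<open>s\<close>, so iterating this reaches every time. The delay
  causes no trouble: delayed arguments on \<open>[s, s + h]\<close> lie in that interval or before \<open>s\<close>,
  where the solution vanishes.
\<close>

lemma zero_data_extend:
  assumes x: "dde_solution m a b \<tau> x"
    and \<tau>: "\<And>i t. i \<in> {1..m} \<Longrightarrow> t \<ge> 0 \<Longrightarrow> \<tau> i t \<ge> 0"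
    and bound: "AE t in lborel. t \<ge> 0 \<longrightarrow> \<bar>a t\<bar> \<le> C \<and> (\<forall>i\<in>{1..m}. \<bar>b i t\<bar> \<le> C)"
    and "C \<ge> 0" and h: "0 < h" "h \<le> 1" "C * (1 + of_nat m) * h \<le> 1/2"
    and "s \<ge> 0" and zero: "\<And>t. t \<in> {0..s} \<Longrightarrow> x t = 0 \<and> hderiv x t = 0"
    and "t \<in> {0..s + h}"
  shows "x t = 0 \<and> hderiv x t = 0"
proof -
  let ?J = "{s..s + h}"
  have ac: "abs_continuous_on {s..r} (hderiv x)" if "r \<ge> s" for r
    using dde_solutionD(2)[OF x, of r] \<open>s \<ge> 0\<close> that abs_continuous_on_subset by fastforce
  have "continuous_on ?J (\<lambda>t. norm (hderiv x t))"
    using abs_continuous_on_imp_continuous_on[OF ac[of "s + h"]] h by (intro continuous_on_norm) simp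
  then obtain r where r: "r \<in> ?J" and max: "\<And>t. t \<in> ?J \<Longrightarrow> norm (hderiv x t) \<le> norm (hderiv x r)"
    using continuous_attains_sup[of ?J "\<lambda>t. norm (hderiv x t)"] h by auto
  define M where "M = norm (hderiv x r)"
  have "M \<ge> 0" by (simp add: M_def)
  have x_le: "norm (x t) \<le> M" if "t \<in> ?J" for t
  proof -
    have "norm (x t - x s) \<le> M * norm (t - s)"
    proof (rule differentiable_bound[of ?J])
      show "(x has_derivative (\<lambda>h. h *\<^sub>R hderiv x t)) (at t within ?J)" if "t \<in> ?J" for t
        using has_vector_derivative_within_subset[OF dde_solutionD(1)[OF x, of t], of ?J] that \<open>s \<ge> 0\<close>
        by (auto simp: has_vector_derivative_def)
      show "onorm (\<lambda>h. h *\<^sub>R hderiv x t) \<le> M" if "t \<in> ?J" for t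
        using max[OF that] by (intro onorm_le) (simp add: M_def mult.commute mult_left_mono)
    qed (use that h in auto)
    also have "\<dots> \<le> M * 1"
      using that h \<open>M \<ge> 0\<close> by (intro mult_left_mono) auto
    finally show ?thesis using zero[of s] \<open>s \<ge> 0\<close> by simp
  qed
  have delayed: "norm (zero_ext x t) \<le> M" if "t \<le> s + h" for t
    using x_le[of t] zero[of t] that \<open>M \<ge> 0\<close> by (cases "t \<le> s") (auto simp: zero_ext_def)
  have "AE t in lborel. t \<in> {s..r} \<longrightarrow>
      (\<exists>d. (hderiv x has_vector_derivative d) (at t within {s..r}) \<and> norm d \<le> C * (1 + of_nat m) * M)"
    using bound dde_solutionD(3)[OF x]
  proof (eventually_elim, intro impI)
    case (elim t)
    assume t: "t \<in> {s..r}"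
    then have "t \<ge> 0" "t \<in> ?J" using \<open>s \<ge> 0\<close> r by auto
    with elim have a: "\<bar>a t\<bar> \<le> C" and b: "\<And>i. i \<in> {1..m} \<Longrightarrow> \<bar>b i t\<bar> \<le> C"
      and "dde_holds_at m a b \<tau> x (hderiv x) t" by auto
    then obtain z where z: "(hderiv x has_vector_derivative z) (at t within {0..})"
      "z + of_real (a t) * hderiv x t + (\<Sum>i = 1..m. of_real (b i t) * zero_ext x (t - \<tau> i t)) = 0"
      unfolding dde_holds_at_def by blast
    let ?S = "\<Sum>i = 1..m. complex_of_real (b i t) * zero_ext x (t - \<tau> i t)"
    have "z = - (of_real (a t) * hderiv x t + ?S)"
      using z(2) by (simp only: eq_neg_iff_add_eq_0 add.assoc)
    then have "norm z = norm (of_real (a t) * hderiv x t + ?S)"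
      by (simp only: norm_minus_cancel)
    also have "\<dots> \<le> norm (of_real (a t) * hderiv x t) + norm ?S"
      by (rule norm_triangle_ineq)
    also have "norm (of_real (a t) * hderiv x t) \<le> C * M"
      unfolding norm_mult using a max[OF \<open>t \<in> ?J\<close>] \<open>C \<ge> 0\<close> by (intro mult_mono) (auto simp: M_def)
    also have "norm ?S \<le> of_nat (card {1..m}) * (C * M)"
    proof (rule sum_norm_bound)
      fix i assume i: "i \<in> {1..m}"
      show "norm (complex_of_real (b i t) * zero_ext x (t - \<tau> i t)) \<le> C * M"
        unfolding norm_mult
        using b[OF i] delayed[of "t - \<tau> i t"] \<tau>[OF i \<open>t \<ge> 0\<close>] \<open>t \<in> ?J\<close> \<open>C \<ge> 0\<close>
        by (intro mult_mono) auto
    qed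
    finally have "norm z \<le> C * (1 + of_nat m) * M"
      by (simp add: algebra_simps)
    moreover have "(hderiv x has_vector_derivative z) (at t within {s..r})"
      using has_vector_derivative_within_subset[OF z(1), of "{s..r}"] \<open>s \<ge> 0\<close> by auto
    ultimately show "\<exists>d. (hderiv x has_vector_derivative d) (at t within {s..r})
        \<and> norm d \<le> C * (1 + of_nat m) * M" by blast
  qed
  then have "norm (hderiv x r - hderiv x s) \<le> C * (1 + of_nat m) * M * (r - s)"
    using r \<open>C \<ge> 0\<close> \<open>M \<ge> 0\<close> by (intro abs_continuous_AE_derivative_bound ac) auto
  also have "\<dots> \<le> C * (1 + of_nat m) * M * h"
    using r \<open>C \<ge> 0\<close> \<open>M \<ge> 0\<close> by (intro mult_left_mono) auto
  also have "\<dots> \<le> 1/2 * M"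
    using mult_right_mono[OF h(3) \<open>M \<ge> 0\<close>] by (simp add: mult_ac)
  finally have "M \<le> 1/2 * M"
    using zero[of s] \<open>s \<ge> 0\<close> by (simp add: M_def)
  with \<open>M \<ge> 0\<close> have "M = 0" by simp
  show ?thesis
  proof (cases "t \<le> s")
    case False
    then have "t \<in> ?J" using \<open>t \<in> {0..s + h}\<close> by simp
    with x_le[of t] max[of t] \<open>M = 0\<close> show ?thesis by (simp add: M_def)
  qed (use zero \<open>t \<in> {0..s + h}\<close> in auto)
qed

lemma ess_bounded_borel_finite_bound:
  assumes "finite F" and "\<And>f. f \<in> F \<Longrightarrow> ess_bounded_borel f"
  shows "\<exists>C\<ge>0. AE t in lborel. t \<ge> 0 \<longrightarrow> (\<forall>f\<in>F. \<bar>f t\<bar> \<le> C)"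
proof -
  have "\<exists>C. AE t in lborel. t \<ge> 0 \<longrightarrow> \<bar>f t\<bar> \<le> C" if f: "f \<in> F" for f
  proof -
    obtain C where "AE t in restrict_space lborel {0..}. \<bar>f t\<bar> \<le> C"
      using assms(2)[OF f] unfolding ess_bounded_borel_def by blast
    then have "AE t in lborel. t \<in> {0..} \<longrightarrow> \<bar>f t\<bar> \<le> C"
      by (subst (asm) AE_restrict_space_iff) auto
    then show ?thesis by auto
  qed
  then obtain B where B: "\<And>f. f \<in> F \<Longrightarrow> AE t in lborel. t \<ge> 0 \<longrightarrow> \<bar>f t\<bar> \<le> B f"
    by metis
  have "AE t in lborel. \<forall>f\<in>F. t \<ge> 0 \<longrightarrow> \<bar>f t\<bar> \<le> B f"
    using B assms(1) by (intro AE_finite_allI) auto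
  moreover have "B f \<le> (\<Sum>g\<in>F. \<bar>B g\<bar>)" if "f \<in> F" for f
    using member_le_sum[of f F "\<lambda>g. \<bar>B g\<bar>"] that assms(1) by auto
  ultimately have "AE t in lborel. t \<ge> 0 \<longrightarrow> (\<forall>f\<in>F. \<bar>f t\<bar> \<le> (\<Sum>g\<in>F. \<bar>B g\<bar>))"
    by (auto elim!: eventually_mono intro: order_trans)
  moreover have "(\<Sum>g\<in>F. \<bar>B g\<bar>) \<ge> 0"
    by (simp add: sum_nonneg)
  ultimately show ?thesis by blast
qed

lemma dde_solution_zero_data:
  assumes x: "dde_solution m a b \<tau> x"
    and a: "ess_bounded_borel a" and b: "\<And>i. i \<in> {1..m} \<Longrightarrow> ess_bounded_borel (b i)"
    and \<tau>: "\<And>i t. i \<in> {1..m} \<Longrightarrow> t \<ge> 0 \<Longrightarrow> \<tau> i t \<ge> 0"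
    and init: "x 0 = 0" "hderiv x 0 = 0" and "t \<ge> 0"
  shows "x t = 0"
proof -
  have "\<And>f. f \<in> insert a (b ` {1..m}) \<Longrightarrow> ess_bounded_borel f"
    using a b by auto
  then have "\<exists>C\<ge>0. AE t in lborel. t \<ge> 0 \<longrightarrow> (\<forall>f\<in>insert a (b ` {1..m}). \<bar>f t\<bar> \<le> C)"
    by (intro ess_bounded_borel_finite_bound) simp_all
  then obtain C where "C \<ge> 0" and "AE t in lborel. t \<ge> 0 \<longrightarrow> (\<forall>f\<in>insert a (b ` {1..m}). \<bar>f t\<bar> \<le> C)"
    by (elim exE conjE) (rule that)
  then have bound: "AE t in lborel. t \<ge> 0 \<longrightarrow> \<bar>a t\<bar> \<le> C \<and> (\<forall>i\<in>{1..m}. \<bar>b i t\<bar> \<le> C)"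
    by (auto elim!: eventually_mono)
  \<comment> \<open>The summand 1 in the denominator gives \<open>h \<le> 1\<close> and covers \<open>C = 0\<close>.\<close>
  define h where "h = 1 / (2 * (1 + C * (1 + of_nat m)))"
  have pos: "C * (1 + of_nat m) \<ge> 0" using \<open>C \<ge> 0\<close> by simp
  then have h: "0 < h" "h \<le> 1" "C * (1 + of_nat m) * h \<le> 1/2"
    by (auto simp: h_def divide_simps)
  have "x t = 0 \<and> hderiv x t = 0" if "t \<in> {0..of_nat n * h}" for n t
    using that
  proof (induction n arbitrary: t)
    case (Suc n)
    have "of_nat n * h \<ge> 0" using h by simp
    from zero_data_extend[OF x \<tau> bound \<open>C \<ge> 0\<close> h this Suc.IH] Suc.prems
    show ?case by (simp add: algebra_simps)
  qed (use init in simp)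
  moreover obtain n :: nat where "t / h \<le> of_nat n"
    using real_arch_simple by blast
  then have "t \<le> of_nat n * h"
    using h by (simp add: field_simps)
  ultimately show ?thesis using \<open>t \<ge> 0\<close> by simp
qed

lemma dde_solution_unique:
  assumes x: "dde_solution m a b \<tau> x" and y: "dde_solution m a b \<tau> y"
    and "ess_bounded_borel a" "\<And>i. i \<in> {1..m} \<Longrightarrow> ess_bounded_borel (b i)"
    and "\<And>i t. i \<in> {1..m} \<Longrightarrow> t \<ge> 0 \<Longrightarrow> \<tau> i t \<ge> 0"
    and "x 0 = y 0" "hderiv x 0 = hderiv y 0" and "t \<ge> 0"
  shows "x t = y t"
proof -
  have "1 * x t + (- 1) * y t = 0"
  proof (rule dde_solution_zero_data[OF dde_solution_lincomb[OF x y] assms(3-5)])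
    show "1 * x 0 + (- 1) * y 0 = 0" using \<open>x 0 = y 0\<close> by simp
    show "hderiv (\<lambda>t. 1 * x t + (- 1) * y t) 0 = 0"
      unfolding hderiv_lincomb(2)[OF x y order_refl] using \<open>hderiv x 0 = hderiv y 0\<close> by simp
  qed (use \<open>t \<ge> 0\<close> in simp_all)
  then show ?thesis by simp
qed

section \<open>Multipliers as eigenvalues of the monodromy matrix\<close>

lemma eigenvector_2x2_iff:
  fixes p q r s \<mu> :: complex
  shows "(\<exists>c d. (c \<noteq> 0 \<or> d \<noteq> 0) \<and> p * c + q * d = \<mu> * c \<and> r * c + s * d = \<mu> * d) \<longleftrightarrow>
    \<mu>\<^sup>2 - (p + s) * \<mu> + (p * s - q * r) = 0"
    (is "?ev \<longleftrightarrow> ?char = 0")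
proof
  assume ?ev
  then obtain c d where nz: "c \<noteq> 0 \<or> d \<noteq> 0"
    and eqs: "p * c + q * d = \<mu> * c" "r * c + s * d = \<mu> * d" by blast
  \<comment> \<open>Multiplying by the adjugate matrix shows that the determinant annihilates an eigenvector.\<close>
  have "?char * c = (\<mu> - s) * (\<mu> * c - (p * c + q * d)) + q * (\<mu> * d - (r * c + s * d))"
    by (simp add: algebra_simps power2_eq_square)
  moreover have "?char * d = r * (\<mu> * c - (p * c + q * d)) + (\<mu> - p) * (\<mu> * d - (r * c + s * d))"
    by (simp add: algebra_simps power2_eq_square)
  ultimately show "?char = 0" using nz eqs by auto
next
  assume char: "?char = 0"
  \<comment> \<open>Each row of the shifted matrix annihilates the vector obtained by swapping its
      entries and changing a sign, and the other row annihilates it because the determinant is 0;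
      a nonzero row therefore yields an eigenvector.\<close>
  consider "q \<noteq> 0 \<or> \<mu> \<noteq> p" | "r \<noteq> 0 \<or> \<mu> \<noteq> s" | "q = 0" "\<mu> = p" "r = 0" "\<mu> = s" by blast
  then show ?ev
  proof cases
    case 1
    have "p * q + q * (\<mu> - p) = \<mu> * q" by (simp add: algebra_simps)
    moreover have "\<mu> * (\<mu> - p) - (r * q + s * (\<mu> - p)) = ?char"
      by (simp add: algebra_simps power2_eq_square)
    ultimately show ?thesis
      using 1 char by (intro exI[of _ q] exI[of _ "\<mu> - p"]) auto
  next
    case 2
    have "\<mu> * (\<mu> - s) - (p * (\<mu> - s) + q * r) = ?char"
      by (simp add: algebra_simps power2_eq_square)
    moreover have "r * (\<mu> - s) + s * r = \<mu> * r" by (simp add: algebra_simps)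
    ultimately show ?thesis
      using 2 char by (intro exI[of _ "\<mu> - s"] exI[of _ r]) auto
  next
    case 3
    then show ?thesis by (intro exI[of _ 1] exI[of _ 0]) auto
  qed
qed

lemma complex_quadratic_root:
  fixes p q :: complex
  shows "\<exists>\<mu>. \<mu>\<^sup>2 - p * \<mu> + q = 0"
proof
  let ?r = "csqrt (p\<^sup>2 - 4 * q)"
  have "((p + ?r) / 2)\<^sup>2 - p * ((p + ?r) / 2) + q = (?r\<^sup>2 - (p\<^sup>2 - 4 * q)) / 4"
    by (simp add: field_simps power2_eq_square)
  then show "((p + ?r) / 2)\<^sup>2 - p * ((p + ?r) / 2) + q = 0"
    by simp
qed

theorem theorem3p1:
  fixes \<omega> :: real and m :: nat
    and a :: "real \<Rightarrow> real" and b \<tau> :: "nat \<Rightarrow> real \<Rightarrow> real"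
    and x\<^sub>1 x\<^sub>2 :: "real \<Rightarrow> complex"
  assumes "\<omega> > 0" and "m \<ge> 1"
    and "ess_bounded_borel a"
    and "\<And>i. i \<in> {1..m} \<Longrightarrow> ess_bounded_borel (b i)"
    and "\<And>i. i \<in> {1..m} \<Longrightarrow> ess_bounded_borel (\<tau> i)"
    and "\<And>i t. i \<in> {1..m} \<Longrightarrow> t \<ge> 0 \<Longrightarrow> \<tau> i t \<ge> 0"
    and "\<And>t. t \<ge> 0 \<Longrightarrow> a (t + \<omega>) = a t"
    and "\<And>i t. i \<in> {1..m} \<Longrightarrow> t \<ge> 0 \<Longrightarrow> b i (t + \<omega>) = b i t"
    and "\<And>i t. i \<in> {1..m} \<Longrightarrow> t \<ge> 0 \<Longrightarrow> \<tau> i (t + \<omega>) = \<tau> i t"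
    and "\<And>i t. i \<in> {1..m} \<Longrightarrow> t \<in> {0..\<omega>} \<Longrightarrow> t - \<tau> i t \<ge> 0"
    and "dde_solution m a b \<tau> x\<^sub>1" and "x\<^sub>1 0 = 1" and "hderiv x\<^sub>1 0 = 0"
    and "dde_solution m a b \<tau> x\<^sub>2" and "x\<^sub>2 0 = 0" and "hderiv x\<^sub>2 0 = 1"
  shows "(\<exists>\<mu> x. floquet_solution m a b \<tau> \<omega> \<mu> x) \<and>
    {\<mu>. \<exists>x. floquet_solution m a b \<tau> \<omega> \<mu> x} =
    {\<mu>. \<mu>\<^sup>2 - (x\<^sub>1 \<omega> + hderiv x\<^sub>2 \<omega>) * \<mu> + wronskian x\<^sub>1 x\<^sub>2 \<omega> = 0}"
proof -
  note sol1 = assms(11) and sol2 = assms(14)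
  let ?p = "x\<^sub>1 \<omega>" and ?q = "x\<^sub>2 \<omega>" and ?r = "hderiv x\<^sub>1 \<omega>" and ?s = "hderiv x\<^sub>2 \<omega>"
  define y where "y = (\<lambda>c d t. c * x\<^sub>1 t + d * x\<^sub>2 t)"
  have y_sol: "dde_solution m a b \<tau> (y c d)" for c d
    unfolding y_def by (rule dde_solution_lincomb[OF sol1 sol2])
  have y_0: "y c d 0 = c" "hderiv (y c d) 0 = d" for c d
    using hderiv_lincomb(2)[OF sol1 sol2, of 0 c d] assms(12,13,15,16) by (auto simp: y_def)
  have y_\<omega>: "y c d \<omega> = ?p * c + ?q * d" "hderiv (y c d) \<omega> = ?r * c + ?s * d" for c d
    using hderiv_lincomb(2)[OF sol1 sol2, of \<omega> c d] \<open>\<omega> > 0\<close> by (auto simp: y_def mult.commute)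
  have unique: "u t = v t" if "dde_solution m a b \<tau> u" "dde_solution m a b \<tau> v"
    "u 0 = v 0" "hderiv u 0 = hderiv v 0" "t \<ge> 0" for u v t
    by (rule dde_solution_unique[OF that(1,2) assms(3,4,6) that(3,4,5)])
  have translate: "dde_solution m a b \<tau> (\<lambda>t. u (t + \<omega>))" "hderiv (\<lambda>t. u (t + \<omega>)) 0 = hderiv u \<omega>"
    if "dde_solution m a b \<tau> u" for u
    using dde_solution_translate[OF that assms(1,7-10)] hderiv_translate[OF that assms(1,7-10), of 0]
    by auto
  have scale: "dde_solution m a b \<tau> (\<lambda>t. \<mu> * u t)" "hderiv (\<lambda>t. \<mu> * u t) 0 = \<mu> * hderiv u 0"
    if "dde_solution m a b \<tau> u" for u \<mu>
    using dde_solution_lincomb[OF that that, of \<mu> 0] hderiv_lincomb(2)[OF that that order_refl, of \<mu> 0]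
    by auto
  \<comment> \<open>\<^const>\<open>hderiv\<close> sees only the values on the half-line, on which the Floquet equation holds.\<close>
  have hderiv_cong: "hderiv u 0 = hderiv v 0" if "dde_solution m a b \<tau> u" "\<And>t. t \<ge> 0 \<Longrightarrow> v t = u t" for u v
  proof -
    have "(v has_vector_derivative hderiv u 0) (at 0 within {0..})"
      by (rule has_vector_derivative_transform[OF _ _ dde_solutionD(1)[OF that(1)]]) (use that(2) in auto)
    then show ?thesis using hderiv_eqI by simp
  qed
  have floquet_iff: "(\<exists>x. floquet_solution m a b \<tau> \<omega> \<mu> x) \<longleftrightarrow>
      (\<exists>c d. (c \<noteq> 0 \<or> d \<noteq> 0) \<and> ?p * c + ?q * d = \<mu> * c \<and> ?r * c + ?s * d = \<mu> * d)" for \<mu>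
  proof
    assume "\<exists>x. floquet_solution m a b \<tau> \<omega> \<mu> x"
    then obtain x where "floquet_solution m a b \<tau> \<omega> \<mu> x" ..
    then have x: "dde_solution m a b \<tau> x" and nt: "nontrivial x"
      and shift: "\<And>t. t \<ge> 0 \<Longrightarrow> x (t + \<omega>) = \<mu> * x t"
      by (simp_all add: floquet_solution_def)
    let ?c = "x 0" and ?d = "hderiv x 0"
    have x_eq: "x t = y ?c ?d t" if "t \<ge> 0" for t
      by (rule unique[OF x y_sol _ _ that]) (simp_all add: y_0)
    have "?c \<noteq> 0 \<or> ?d \<noteq> 0"
    proof (rule ccontr)
      assume "\<not> ?thesis"
      then have "x t = 0" if "t \<ge> 0" for t using x_eq[OF that] by (simp add: y_def)
      with nt show False by (auto simp: nontrivial_def)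
    qed
    moreover have "y ?c ?d \<omega> = \<mu> * ?c"
      using shift[of 0] x_eq[of \<omega>] \<open>\<omega> > 0\<close> by simp
    moreover have "hderiv (y ?c ?d) \<omega> = \<mu> * ?d"
    proof -
      have "\<mu> * x t = y ?c ?d (t + \<omega>)" if "t \<ge> 0" for t
        using shift[OF that] x_eq[of "t + \<omega>"] that \<open>\<omega> > 0\<close> by simp
      then have "hderiv (\<lambda>t. y ?c ?d (t + \<omega>)) 0 = hderiv (\<lambda>t. \<mu> * x t) 0"
        by (rule hderiv_cong[OF translate(1)[OF y_sol]])
      then show ?thesis using translate(2)[OF y_sol] scale(2)[OF x] by simp
    qed
    ultimately show "\<exists>c d. (c \<noteq> 0 \<or> d \<noteq> 0) \<and> ?p * c + ?q * d = \<mu> * c \<and> ?r * c + ?s * d = \<mu> * d"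
      using y_\<omega> by metis
  next
    assume "\<exists>c d. (c \<noteq> 0 \<or> d \<noteq> 0) \<and> ?p * c + ?q * d = \<mu> * c \<and> ?r * c + ?s * d = \<mu> * d"
    then obtain c d where nz: "c \<noteq> 0 \<or> d \<noteq> 0"
      and ev: "y c d \<omega> = \<mu> * c" "hderiv (y c d) \<omega> = \<mu> * d"
      using y_\<omega> by metis
    have "y c d (t + \<omega>) = \<mu> * y c d t" if "t \<ge> 0" for t
      by (rule unique[OF translate(1)[OF y_sol] scale(1)[OF y_sol] _ _ that])
        (simp_all add: translate(2)[OF y_sol] scale(2)[OF y_sol] y_0 ev)
    moreover have "nontrivial (y c d)"
    proof (rule ccontr)
      assume "\<not> nontrivial (y c d)"
      then have "y c d t = y 0 0 t" if "t \<ge> 0" for t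
        using that by (auto simp: nontrivial_def y_def)
      then have "y 0 0 0 = y c d 0" "hderiv (y 0 0) 0 = hderiv (y c d) 0"
        using hderiv_cong[OF y_sol, of "y c d" 0 0] by simp_all
      with nz show False by (simp add: y_0)
    qed
    ultimately show "\<exists>x. floquet_solution m a b \<tau> \<omega> \<mu> x"
      using y_sol unfolding floquet_solution_def by blast
  qed
  have char: "(\<exists>x. floquet_solution m a b \<tau> \<omega> \<mu> x) \<longleftrightarrow>
      \<mu>\<^sup>2 - (?p + ?s) * \<mu> + wronskian x\<^sub>1 x\<^sub>2 \<omega> = 0" for \<mu>
    unfolding floquet_iff eigenvector_2x2_iff wronskian_def by simp
  show ?thesis
    using char complex_quadratic_root[of "?p + ?s" "wronskian x\<^sub>1 x\<^sub>2 \<omega>"] by simp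
qed

end
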